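(* For any convex polytope $P$, $$f_{K_P}(t)=F_P(-1,t+1).$$
   Context: Let $P$ be a convex polytope (not necessarily simple) with facets $\mathcal{F}_1,\dots,\mathcal{F}_m$. The simplicial complex $K_P$ on $[m]=\{1,\dots,m\}$ consists of the empty set and all $\{i_1,\dots,i_k\}$ with $\mathcal{F}_{i_1}\cap\dots\cap\mathcal{F}_{i_k}\neq\varnothing$. For a finite simplicial complex $K$, $f_K(t)=\sum_{\sigma\in K}t^{|\sigma|}$ (including the empty simplex), with $|\sigma|$ the number of vertices of $\sigma$. For a face $F$ of $P$, $m(F)$ is the number of facets of $P$ containing $F$. The two-dimensional face polynomial of $P$ is $$F_P(\alpha,t)=\sum_{F\subseteq P}\alpha^{\dim F}t^{m(F)},$$ the sum being over all nonempty faces of $P$, including $P$ itself. *)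

theory Defs
  imports "HOL-Analysis.Polytope" "HOL-Computational_Algebra.Polynomial"
begin

text \<open>
  The complex \<open>K\<^sub>P\<close> on the vertex set \<open>{1..m}\<close>; the intended argument \<open>\<F>\<close> enumerates the facets of
  a polytope by \<open>{1..m}\<close>.
\<close>

definition facet_complex :: "nat \<Rightarrow> (nat \<Rightarrow> 'a set) \<Rightarrow> nat set set" where
  "facet_complex m \<F> = insert {} {I. I \<noteq> {} \<and> I \<subseteq> {1..m} \<and> (\<Inter>i\<in>I. \<F> i) \<noteq> {}}"

definition f_polynomial :: "'v set set \<Rightarrow> int poly" where
  "f_polynomial K = (\<Sum>\<sigma>\<in>K. monom 1 (card \<sigma>))"

definition num_facets_containing :: "'a::euclidean_space set \<Rightarrow> 'a set \<Rightarrow> nat" where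
  "num_facets_containing P F = card {G. G facet_of P \<and> F \<subseteq> G}"

text \<open>
  The face polynomial \<open>F\<^sub>P(\<alpha>, t)\<close> as an element of \<open>\<int>[t][\<alpha>]\<close>: the outer variable is \<open>\<alpha>\<close> and the
  inner one is \<open>t\<close>.  The cast \<^const>\<open>nat\<close> is harmless because nonempty faces have nonnegative
  affine dimension.
\<close>

definition face_polynomial2 :: "'a::euclidean_space set \<Rightarrow> int poly poly" where
  "face_polynomial2 P =
     (\<Sum>F | F face_of P \<and> F \<noteq> {}. monom (monom 1 (num_facets_containing P F)) (nat (aff_dim F)))"

text \<open>Substitution of \<open>a\<close> for \<open>\<alpha>\<close> and of \<open>q(t)\<close> for \<open>t\<close> in an element of \<open>\<int>[t][\<alpha>]\<close>.\<close>

definition subst2 :: "int poly poly \<Rightarrow> int \<Rightarrow> int poly \<Rightarrow> int poly" where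
  "subst2 p a q = pcompose (poly p [:a:]) q"

end

theory Submission
  imports Defs
begin

text \<open>
  Expanding \<open>(1 + t)^m(F)\<close> over the sets of facets containing \<open>F\<close> and exchanging the sums, the
  coefficient belonging to a set \<open>A\<close> of facets is the alternating count of the nonempty faces of
  \<open>\<Inter>A\<close>, so everything reduces to the Euler relation \<open>\<Sum>\<^sub>F (-1)^dim F = 1\<close> for polytopes.

  The Euler relation is proved by sweeping a hyperplane \<open>a \<bullet> x = c\<close> across \<open>P\<close> and induction on the
  dimension.  The nonempty faces of a slice correspond to the faces of \<open>P\<close> whose relative interior
  is met, and the dimension drops by one unless the face lies in the hyperplane.  Let \<open>T\<close> be the
  finite set of heights at which some face begins or ends.  A face that is not horizontal crosses
  one more gap between consecutive elements of \<open>T\<close> than it crosses elements of \<open>T\<close>, and a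
  horizontal one crosses one element and no gap.  Hence the alternating face count of \<open>P\<close> is the
  sum of the counts of the slices at \<open>T\<close> minus the sum of those in the gaps, that is,
  \<open>card T - (card T - 1)\<close>.
\<close>

section \<open>Faces of a polyhedron and their hyperplane slices\<close>

definition parity_sign :: "'a::euclidean_space set \<Rightarrow> int" where
  "parity_sign F = (-1) ^ nat (aff_dim F)"

text \<open>The smallest face containing \<open>x\<close> works: on its relative boundary,
  \<open>x\<close> would lie in one of its facets, which is a smaller face of
  \<open>S\<close>.\<close>

lemma polyhedron_point_in_rel_interior_face:
  fixes S :: "'a::euclidean_space set"
  assumes "polyhedron S" "x \<in> S"
  obtains F where "F face_of S" "x \<in> rel_interior F"
proof -
  define M where "M = \<Inter>{F. F face_of S \<and> x \<in> F}"
  have S: "S \<in> {F. F face_of S \<and> x \<in> F}"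
    using assms by (simp add: face_of_refl polyhedron_imp_convex)
  have M: "M face_of S"
    unfolding M_def using S by (intro face_of_Inter) auto
  have "x \<in> M"
    by (auto simp: M_def)
  have "x \<in> rel_interior M"
  proof (rule ccontr)
    assume "x \<notin> rel_interior M"
    moreover have "polyhedron M"
      using M assms(1) face_of_polyhedron_polyhedron by blast
    ultimately obtain G where G: "G facet_of M" "x \<in> G"
      using rel_boundary_of_polyhedron \<open>x \<in> M\<close> by blast
    then have "G face_of S"
      using M face_of_trans facet_of_imp_face_of by blast
    then have "M \<subseteq> G"
      using G by (auto simp: M_def)
    with facet_of_imp_subset[OF G(1)] have "G = M"
      by simp
    with G(1) show False
      by (simp add: facet_of_irrefl)
  qed
  with M show ?thesis
    using that by blast
qed

text \<open>A hyperplane meeting \<open>rel_interior F\<close> cuts out of it a nonempty, relatively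
  open piece of the flat \<open>affine hull F \<inter> ?H\<close>, so the slice has the full
  dimension of that flat.\<close>

lemma aff_dim_Int_hyperplane_rel_interior:
  fixes F :: "'a::euclidean_space set"
  assumes "rel_interior F \<inter> {x. a \<bullet> x = c} \<noteq> {}"
  shows "aff_dim (F \<inter> {x. a \<bullet> x = c}) =
         (if F \<subseteq> {x. a \<bullet> x = c} then aff_dim F else aff_dim F - 1)"
proof -
  let ?H = "{x. a \<bullet> x = c}"
  have H: "affine ?H" by (rule affine_hyperplane)
  have "openin (top_of_set (affine hull F \<inter> ?H)) (rel_interior F \<inter> ?H)"
    using openin_rel_interior[of F] by (auto simp: openin_open)
  then have "aff_dim (rel_interior F \<inter> ?H) = aff_dim (affine hull F \<inter> ?H)"
    using assms by (intro aff_dim_openin affine_Int H affine_affine_hull)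
  moreover have "aff_dim (rel_interior F \<inter> ?H) \<le> aff_dim (F \<inter> ?H)"
    by (intro aff_dim_subset Int_mono rel_interior_subset order_refl)
  moreover have "aff_dim (F \<inter> ?H) \<le> aff_dim (affine hull F \<inter> ?H)"
    by (intro aff_dim_subset Int_mono hull_subset order_refl)
  ultimately have "aff_dim (F \<inter> ?H) = aff_dim (affine hull F \<inter> ?H)"
    by linarith
  moreover have "affine hull F \<inter> ?H \<noteq> {}"
    using assms rel_interior_subset[of F] hull_subset[of F affine] by blast
  moreover have "affine hull F \<subseteq> ?H \<longleftrightarrow> F \<subseteq> ?H"
    using hull_minimal[of F ?H affine] hull_subset[of F affine] H by auto
  ultimately show ?thesis
    by (simp add: aff_dim_affine_Int_hyperplane)
qed

text \<open>The inverse sends \<open>G\<close> to the face of \<open>P\<close> whose relative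
  interior contains a given point of \<open>rel_interior G\<close>. Since slicing by
  \<open>H\<close> commutes with taking relative interiors of the faces it crosses, and faces with
  meeting relative interiors coincide, this is well defined.\<close>

lemma bij_betw_faces_hyperplane_slice:
  fixes P :: "'a::euclidean_space set" and a :: 'a and c :: real
  assumes "polyhedron P"
  defines "H \<equiv> {x. a \<bullet> x = c}"
  shows "bij_betw (\<lambda>F. F \<inter> H) {F. F face_of P \<and> rel_interior F \<inter> H \<noteq> {}}
           {G. G face_of (P \<inter> H) \<and> G \<noteq> {}}"
proof -
  have H: "convex H" "rel_interior H = H"
    by (auto simp: H_def convex_hyperplane rel_interior_affine affine_hyperplane)
  have slice: "rel_interior (F \<inter> H) = rel_interior F \<inter> H"
    if "F face_of P" "rel_interior F \<inter> H \<noteq> {}" for F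
    using that H convex_rel_interior_inter_two[of F H] face_of_imp_convex by auto
  show ?thesis
  proof (rule bij_betw_imageI)
    show "inj_on (\<lambda>F. F \<inter> H) {F. F face_of P \<and> rel_interior F \<inter> H \<noteq> {}}"
    proof (rule inj_onI; clarify)
      fix F F'
      assume F: "F face_of P" "rel_interior F \<inter> H \<noteq> {}"
        and F': "F' face_of P" "rel_interior F' \<inter> H \<noteq> {}" and eq: "F \<inter> H = F' \<inter> H"
      have "rel_interior F \<inter> rel_interior F' \<noteq> {}"
        using slice[OF F] slice[OF F'] eq F(2) by auto
      with F(1) F'(1) show "F = F'"
        by (rule face_of_eq)
    qed
    show "(\<lambda>F. F \<inter> H) ` {F. F face_of P \<and> rel_interior F \<inter> H \<noteq> {}} =
      {G. G face_of (P \<inter> H) \<and> G \<noteq> {}}"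
    proof (intro equalityI subsetI)
      fix G assume "G \<in> {G. G face_of (P \<inter> H) \<and> G \<noteq> {}}"
      then have G: "G face_of (P \<inter> H)" "G \<noteq> {}" by auto
      then obtain x where x: "x \<in> rel_interior G"
        using face_of_imp_convex rel_interior_eq_empty by blast
      then have "x \<in> P \<inter> H"
        using G(1) face_of_imp_subset rel_interior_subset by blast
      then obtain F where F: "F face_of P" "x \<in> rel_interior F"
        using polyhedron_point_in_rel_interior_face[OF assms(1)] by blast
      then have cross: "rel_interior F \<inter> H \<noteq> {}"
        using \<open>x \<in> P \<inter> H\<close> by auto
      have "F \<inter> H face_of P \<inter> H"
        using F(1) H(1) by (rule face_of_slice)
      then have "G = F \<inter> H"
        using G(1) x F \<open>x \<in> P \<inter> H\<close> slice[OF F(1) cross]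
        by (intro face_of_eq[of G "P \<inter> H" "F \<inter> H"]) auto
      then show "G \<in> (\<lambda>F. F \<inter> H) ` {F. F face_of P \<and> rel_interior F \<inter> H \<noteq> {}}"
        using F(1) cross by auto
    next
      fix G assume "G \<in> (\<lambda>F. F \<inter> H) ` {F. F face_of P \<and> rel_interior F \<inter> H \<noteq> {}}"
      then show "G \<in> {G. G face_of (P \<inter> H) \<and> G \<noteq> {}}"
        using face_of_slice[OF _ H(1)] rel_interior_subset by blast
    qed
  qed
qed

section \<open>Heights at which a single face is crossed\<close>

lemma compact_convex_inner_image:
  fixes F :: "'a::euclidean_space set"
  assumes "compact F" "convex F" "F \<noteq> {}"
  obtains l u where "l \<le> u" "(\<lambda>x. a \<bullet> x) ` F = {l..u}"
proof -
  have "compact ((\<lambda>x. a \<bullet> x) ` F)"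
    by (intro compact_continuous_image assms continuous_intros)
  moreover have "connected ((\<lambda>x. a \<bullet> x) ` F)"
    by (intro connected_continuous_image convex_connected assms continuous_intros)
  ultimately obtain l u where lu: "(\<lambda>x. a \<bullet> x) ` F = {l..u}"
    using connected_compact_interval_1[of "(\<lambda>x. a \<bullet> x) ` F"] by auto
  have "{l..u} \<noteq> {}"
    unfolding lu[symmetric] using assms(3) by simp
  with lu show ?thesis
    using that by auto
qed

text \<open>Linear images commute with relative interiors. For an image \<open>{l..u}\<close> the
  crossing heights are thus the open interval if \<open>l < u\<close>, but the single point
  \<open>l\<close> if \<open>l = u\<close>.\<close>

lemma rel_interior_meets_hyperplane_iff:
  fixes F :: "'a::euclidean_space set"
  assumes "convex F"
  shows "rel_interior F \<inter> {x. a \<bullet> x = c} \<noteq> {} \<longleftrightarrow> c \<in> rel_interior ((\<lambda>x. a \<bullet> x) ` F)"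
proof -
  have "linear (\<lambda>x. a \<bullet> x)"
    by (rule bounded_linear.linear[OF bounded_linear_inner_right])
  from rel_interior_convex_linear_image[OF this assms]
  have "c \<in> rel_interior ((\<lambda>x. a \<bullet> x) ` F) \<longleftrightarrow> c \<in> (\<lambda>x. a \<bullet> x) ` rel_interior F"
    by simp
  then show ?thesis
    by auto
qed

text \<open>Here \<open>g c\<close> is a sample height in the gap of \<open>T\<close> after
  \<open>c\<close>, and \<open>w c\<close> is the contribution of \<open>F\<close> to the slice at
  height \<open>c\<close>.\<close>

lemma sum_slices_eq_parity_sign:
  fixes F :: "'a::euclidean_space set" and T :: "real set"
  assumes F: "convex F" "(\<lambda>x. a \<bullet> x) ` F = {l..u}" "l \<le> u"
    and T: "finite T" "l \<in> T" "u \<in> T" "T' = T - {Max T}"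
    and g: "\<And>c. c \<in> T' \<Longrightarrow> c < g c" "\<And>c d. c \<in> T' \<Longrightarrow> d \<in> T \<Longrightarrow> c < d \<Longrightarrow> g c < d"
  defines "w \<equiv> \<lambda>c. if rel_interior F \<inter> {x. a \<bullet> x = c} \<noteq> {}
                    then parity_sign (F \<inter> {x. a \<bullet> x = c}) else 0"
  shows "(\<Sum>c\<in>T. w c) - (\<Sum>c\<in>T'. w (g c)) = parity_sign F"
proof (cases "l = u")
  case True
  have sub: "F \<subseteq> {x. a \<bullet> x = l}"
    using F(2) True by auto
  have "F \<noteq> {}" using F by auto
  have w: "w c = (if c = l then parity_sign F else 0)" for c
    unfolding w_def rel_interior_meets_hyperplane_iff[OF F(1)]
    using sub by (simp add: F(2) True Int_absorb2)
  \<comment> \<open>A horizontal face sits at a height in \<open>T\<close>, which no sample height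
    equals.\<close>
  have "w (g c) = 0" if "c \<in> T'" for c
  proof -
    have "g c \<noteq> l"
      using g(1)[OF that] g(2)[OF that T(2)] by (cases "c < l") auto
    then show ?thesis by (simp add: w)
  qed
  moreover have "(\<Sum>c\<in>T. w c) = parity_sign F"
    using T(1,2) by (simp add: w)
  ultimately show ?thesis by simp
next
  case False
  then have "l < u" using F(3) by simp
  have nsub: "\<not> F \<subseteq> {x. a \<bullet> x = c}" for c
  proof
    assume "F \<subseteq> {x. a \<bullet> x = c}"
    then have "(\<lambda>x. a \<bullet> x) ` F \<subseteq> {c}" by auto
    moreover have "l \<in> (\<lambda>x. a \<bullet> x) ` F" "u \<in> (\<lambda>x. a \<bullet> x) ` F"
      using F(3) unfolding F(2) by simp_all
    ultimately have "l = c" "u = c" by blast+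
    with False show False by simp
  qed
  \<comment> \<open>This keeps \<open>nat\<close> from truncating \<open>aff_dim F - 1\<close>, so
    that lowering the dimension by one flips the sign.\<close>
  have dim: "aff_dim F \<ge> 1"
  proof (rule ccontr)
    assume "\<not> aff_dim F \<ge> 1"
    then have "aff_dim F = -1 \<or> aff_dim F = 0"
      using aff_dim_geq[of F] by linarith
    then show False
      using nsub aff_dim_empty[of F] by (auto simp: aff_dim_eq_0)
  qed
  have w: "w c = (if l < c \<and> c < u then - parity_sign F else 0)" for c
  proof -
    have "parity_sign (F \<inter> {x. a \<bullet> x = c}) = - parity_sign F"
      if "rel_interior F \<inter> {x. a \<bullet> x = c} \<noteq> {}"
    proof -
      have "nat (aff_dim F) = Suc (nat (aff_dim F - 1))" using dim by simp
      then show ?thesis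
        using aff_dim_Int_hyperplane_rel_interior[OF that] nsub
        by (simp add: parity_sign_def)
    qed
    then show ?thesis
      unfolding w_def using rel_interior_meets_hyperplane_iff[OF F(1), of a c]
      by (auto simp: F(2) \<open>l < u\<close>)
  qed
  have below_Max: "c \<noteq> Max T" if "c < u" for c
    using that Max_ge[OF T(1,3)] by linarith
  have "(\<Sum>c\<in>T'. w (g c)) = (\<Sum>c\<in>T'. if l \<le> c \<and> c < u then - parity_sign F else 0)"
  proof (rule sum.cong[OF refl])
    fix c assume c: "c \<in> T'"
    have "l < g c \<longleftrightarrow> l \<le> c" "g c < u \<longleftrightarrow> c < u"
      using g(1)[OF c] g(2)[OF c T(2)] g(2)[OF c T(3)]
      by (cases "c < l"; cases "c < u"; simp)+
    then show "w (g c) = (if l \<le> c \<and> c < u then - parity_sign F else 0)"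
      by (simp add: w)
  qed
  also have "\<dots> = - parity_sign F * card {c\<in>T'. l \<le> c \<and> c < u}"
    using T by (simp add: sum.If_cases Int_def)
  \<comment> \<open>The height \<open>l\<close> is not crossed, but the gap after it is: this is the
    surplus gap. Removing \<open>Max T\<close> loses nothing, as only heights below \<open>u\<close>
    count.\<close>
  also have "{c\<in>T'. l \<le> c \<and> c < u} = insert l {c\<in>T. l < c \<and> c < u}"
    using T \<open>l < u\<close> below_Max by auto
  finally have "(\<Sum>c\<in>T'. w (g c)) = - parity_sign F * (1 + card {c\<in>T. l < c \<and> c < u})"
    using T(1) by simp
  moreover have "(\<Sum>c\<in>T. w c) = - parity_sign F * card {c\<in>T. l < c \<and> c < u}"
    using T by (simp add: w sum.If_cases Int_def)
  ultimately show ?thesis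
    by (simp add: algebra_simps)
qed

section \<open>The Euler relation by sweeping\<close>

theorem Euler_relation_polytope:
  fixes P :: "'a::euclidean_space set"
  assumes "polytope P" "P \<noteq> {}"
  shows "(\<Sum>F | F face_of P \<and> F \<noteq> {}. parity_sign F) = 1"
  using assms
proof (induction "nat (aff_dim P)" arbitrary: P rule: less_induct)
  case less
  have conv: "convex P" and cpt: "compact P" and poly: "polyhedron P"
    using less.prems(1) by (auto simp: polytope_imp_convex polytope_imp_compact polytope_imp_polyhedron)
  show ?case
  proof (cases "\<exists>p. P = {p}")
    case True
    then obtain p where "P = {p}" by blast
    then have "{F. F face_of P \<and> F \<noteq> {}} = {P}"
      using face_of_imp_subset conv face_of_refl by fastforce
    then show ?thesis
      using \<open>P = {p}\<close> by (simp add: parity_sign_def)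
  next
    case False
    then obtain p q where pq: "p \<in> P" "q \<in> P" "p \<noteq> q"
      using less.prems(2) by blast
    \<comment> \<open>This direction separates \<open>p\<close> from \<open>q\<close>, so no
      hyperplane orthogonal to it contains \<open>P\<close> and every slice has smaller
      dimension.\<close>
    define a where "a = p - q"
    have "a \<bullet> p - a \<bullet> q = a \<bullet> a"
      by (simp add: a_def inner_diff_right)
    then have "a \<bullet> p \<noteq> a \<bullet> q"
      using pq(3) by (auto simp: a_def)
    define \<Phi> where "\<Phi> = {F. F face_of P \<and> F \<noteq> {}}"
    have fin: "finite \<Phi>"
      unfolding \<Phi>_def using finite_polytope_faces[OF less.prems(1)] by simp
    have "\<exists>l u. l \<le> u \<and> (\<lambda>x. a \<bullet> x) ` F = {l..u}" if "F \<in> \<Phi>" for F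
    proof -
      have "compact F" "convex F" "F \<noteq> {}"
        using that conv cpt face_of_imp_compact face_of_imp_convex by (auto simp: \<Phi>_def)
      then show ?thesis using compact_convex_inner_image by metis
    qed
    then obtain l u where lu: "\<And>F. F \<in> \<Phi> \<Longrightarrow> l F \<le> u F" "\<And>F. F \<in> \<Phi> \<Longrightarrow> (\<lambda>x. a \<bullet> x) ` F = {l F..u F}"
      by metis
    define T where "T = l ` \<Phi> \<union> u ` \<Phi>"
    have "P \<in> \<Phi>"
      using conv less.prems(2) by (simp add: \<Phi>_def face_of_refl)
    have T: "finite T" "T \<noteq> {}"
      using fin \<open>P \<in> \<Phi>\<close> by (auto simp: T_def)
    define T' where "T' = T - {Max T}"
    \<comment> \<open>the midpoint of the gap following \<open>c\<close>; junk for \<open>c = Max T\<close>, hence \<open>T'\<close>\<close>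
    define g where "g c = (c + Min {d \<in> T. c < d}) / 2" for c
    have succ: "c < Min {d \<in> T. c < d}" "Min {d \<in> T. c < d} \<in> T" if "c \<in> T'" for c
    proof -
      have "Max T \<in> T" "c < Max T"
        using that T Max_ge[of T c] by (auto simp: T'_def order_less_le)
      then have "Min {d \<in> T. c < d} \<in> {d \<in> T. c < d}"
        using T(1) by (intro Min_in) auto
      then show "c < Min {d \<in> T. c < d}" "Min {d \<in> T. c < d} \<in> T" by auto
    qed
    have g1: "c < g c" if "c \<in> T'" for c
      using succ(1)[OF that] by (simp add: g_def)
    have g2: "g c < d" if "c \<in> T'" "d \<in> T" "c < d" for c d
    proof -
      have "Min {d \<in> T. c < d} \<le> d"
        using T(1) that by (intro Min_le) auto
      then show ?thesis
        using succ(1)[OF that(1)] that(3) by (simp add: g_def)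
    qed
    \<comment> \<open>Extending by zero to uncrossed faces makes the index set independent of
      \<open>c\<close>, so that the sums over faces and heights can be exchanged.\<close>
    define w where "w F c = (if rel_interior F \<inter> {x. a \<bullet> x = c} \<noteq> {}
                     then parity_sign (F \<inter> {x. a \<bullet> x = c}) else 0)" for F c
    have slice: "(\<Sum>F\<in>\<Phi>. w F c) = 1" if c: "c \<in> {l P..u P}" for c
    proof -
      define H where "H = {x. a \<bullet> x = c}"
      have "P \<inter> H \<noteq> {}"
        using c lu(2)[OF \<open>P \<in> \<Phi>\<close>] by (force simp: H_def)
      have "polytope (P \<inter> H)"
        unfolding H_def by (intro polytope_Int_polyhedron less.prems polyhedron_hyperplane)
      have "affine hull (P \<inter> H) \<subseteq> H"
        unfolding H_def by (intro hull_minimal affine_hyperplane) auto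
      moreover have "\<not> affine hull P \<subseteq> H"
      proof
        assume "affine hull P \<subseteq> H"
        then have "p \<in> H" "q \<in> H"
          using pq hull_subset[of P affine] by blast+
        with \<open>a \<bullet> p \<noteq> a \<bullet> q\<close> show False by (simp add: H_def)
      qed
      ultimately have "affine hull (P \<inter> H) \<subset> affine hull P"
        using hull_mono[of "P \<inter> H" P affine] by blast
      then have "aff_dim (P \<inter> H) < aff_dim P"
        by (rule aff_dim_psubset)
      \<comment> \<open>Needed for the strict inequality to survive \<open>nat\<close> in the
        induction measure.\<close>
      moreover have "aff_dim (P \<inter> H) \<ge> 0"
        using \<open>P \<inter> H \<noteq> {}\<close> aff_dim_geq[of "P \<inter> H"] aff_dim_empty[of "P \<inter> H"] by simp
      ultimately have "(\<Sum>G | G face_of (P \<inter> H) \<and> G \<noteq> {}. parity_sign G) = 1"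
        using \<open>polytope (P \<inter> H)\<close> \<open>P \<inter> H \<noteq> {}\<close> by (intro less.hyps) auto
      also have "(\<Sum>G | G face_of (P \<inter> H) \<and> G \<noteq> {}. parity_sign G) =
          (\<Sum>F | F face_of P \<and> rel_interior F \<inter> H \<noteq> {}. parity_sign (F \<inter> H))"
        unfolding H_def
        by (rule sum.reindex_bij_betw[OF bij_betw_faces_hyperplane_slice[OF poly], symmetric])
      also have "\<dots> = (\<Sum>F\<in>\<Phi>. w F c)"
        using fin unfolding w_def H_def[symmetric]
        by (intro sum.mono_neutral_cong_left) (auto simp: \<Phi>_def)
      finally show ?thesis by simp
    qed
    have T_range: "T \<subseteq> {l P..u P}"
    proof -
      have "{l F..u F} \<subseteq> {l P..u P}" if "F \<in> \<Phi>" for F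
      proof -
        have "F \<subseteq> P" using that face_of_imp_subset by (auto simp: \<Phi>_def)
        then show ?thesis
          using lu(2)[OF that] lu(2)[OF \<open>P \<in> \<Phi>\<close>] by blast
      qed
      then show ?thesis
        using lu(1) by (force simp: T_def)
    qed
    \<comment> \<open>Midpoints of heights in \<open>T\<close> stay in the range of heights of
      \<open>P\<close>, so the slices in the gaps are nonempty and \<open>slice\<close> applies to
      them.\<close>
    have g_range: "g c \<in> {l P..u P}" if "c \<in> T'" for c
    proof -
      have "c \<in> {l P..u P}" "Min {d \<in> T. c < d} \<in> {l P..u P}"
        using that T_range succ(2)[OF that] by (auto simp: T'_def)
      then show ?thesis by (simp add: g_def)
    qed
    have "(\<Sum>F\<in>\<Phi>. parity_sign F) = (\<Sum>F\<in>\<Phi>. (\<Sum>c\<in>T. w F c) - (\<Sum>c\<in>T'. w F (g c)))"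
    proof (rule sum.cong[OF refl])
      fix F assume F: "F \<in> \<Phi>"
      have "convex F" "l F \<in> T" "u F \<in> T"
        using F face_of_imp_convex by (auto simp: \<Phi>_def T_def)
      then show "parity_sign F = (\<Sum>c\<in>T. w F c) - (\<Sum>c\<in>T'. w F (g c))"
        unfolding w_def
        by (intro sum_slices_eq_parity_sign[OF _ lu(2)[OF F] lu(1)[OF F] T(1) _ _ T'_def g1 g2, symmetric])
    qed
    also have "\<dots> = (\<Sum>c\<in>T. \<Sum>F\<in>\<Phi>. w F c) - (\<Sum>c\<in>T'. \<Sum>F\<in>\<Phi>. w F (g c))"
      by (simp add: sum_subtractf sum.swap[of _ _ \<Phi>])
    also have "\<dots> = int (card T) - int (card T')"
      using slice T_range g_range by (simp add: subset_eq)
    also have "\<dots> = 1"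
      using T Max_in[OF T] by (simp add: T'_def card_Diff_singleton of_nat_diff Suc_leI card_gt_0_iff)
    finally show ?thesis by (simp add: \<Phi>_def)
  qed
qed

section \<open>Expansion of the face polynomial over sets of facets\<close>

lemma linear_plus_one_power:
  fixes A :: "'b set"
  assumes "finite A"
  shows "[:1, 1:] ^ card A = (\<Sum>B\<in>Pow A. monom (1::'c::comm_semiring_1) (card B))"
proof -
  have "[:1, 1:] ^ card A = (\<Prod>x\<in>A. monom 1 1 + (1 :: 'c poly))"
    by (simp add: monom_altdef one_pCons)
  also have "\<dots> = (\<Sum>B\<in>Pow A. monom 1 (card B))"
    by (subst prod_add[OF assms]) (simp add: monom_power)
  finally show ?thesis .
qed

lemma subst2_face_polynomial2:
  "subst2 (face_polynomial2 P) (-1) q =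
     (\<Sum>F | F face_of P \<and> F \<noteq> {}. [:parity_sign F:] * q ^ num_facets_containing P F)"
proof -
  have "[:-1:] ^ n = [:(-1::int) ^ n:]" for n
    by (induction n) (auto simp: one_pCons)
  moreover have "pcompose (monom 1 n) q = q ^ n" for n
    by (induction n) (simp_all add: monom_0 monom_Suc pcompose_pCons one_pCons)
  ultimately show ?thesis
    by (simp add: subst2_def face_polynomial2_def poly_sum poly_monom pcompose_sum pcompose_smult
        parity_sign_def)
qed

theorem corollary10:
  fixes P :: "'a::euclidean_space set" and \<F> :: "nat \<Rightarrow> 'a set" and m :: nat
  assumes "polytope P" and "P \<noteq> {}"
    and "bij_betw \<F> {1..m} {G. G facet_of P}"
  shows "f_polynomial (facet_complex m \<F>) = subst2 (face_polynomial2 P) (-1) [:1, 1:]"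
proof -
  define \<Phi> where "\<Phi> = {F. F face_of P \<and> F \<noteq> {}}"
  define X where "X F = {i \<in> {1..m}. F \<subseteq> \<F> i}" for F
  have fin: "finite \<Phi>"
    unfolding \<Phi>_def using finite_polytope_faces[OF assms(1)] by simp
  have X: "finite (X F)" "card (X F) = num_facets_containing P F" for F
  proof -
    show "finite (X F)" by (simp add: X_def)
    have "bij_betw \<F> (X F) {G. G facet_of P \<and> F \<subseteq> G}"
    proof (rule bij_betw_subset[OF assms(3)])
      show "X F \<subseteq> {1..m}" by (auto simp: X_def)
      have "{G. G facet_of P \<and> F \<subseteq> G} = {G \<in> \<F> ` {1..m}. F \<subseteq> G}"
        unfolding bij_betw_imp_surj_on[OF assms(3)] by simp
      then show "\<F> ` X F = {G. G facet_of P \<and> F \<subseteq> G}"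
        by (auto simp: X_def)
    qed
    then show "card (X F) = num_facets_containing P F"
      unfolding num_facets_containing_def by (rule bij_betw_same_card)
  qed
  have key: "(\<Sum>F | F \<in> \<Phi> \<and> A \<subseteq> X F. parity_sign F) = (if A \<in> facet_complex m \<F> then 1 else 0)"
    if A: "A \<subseteq> {1..m}" for A
  proof -
    \<comment> \<open>Intersecting with \<open>P\<close> makes the empty index set yield
      \<open>P\<close> itself, in accordance with the empty simplex always belonging to the
      complex.\<close>
    define G where "G = P \<inter> (\<Inter>i\<in>A. \<F> i)"
    have facet: "\<F> i face_of P" if "i \<in> A" for i
    proof -
      have "\<F> i facet_of P"
        using A that bij_betw_apply[OF assms(3), of i] by auto
      then show ?thesis by (rule facet_of_imp_face_of)
    qed
    have "P face_of P"
      using assms(1) by (simp add: face_of_refl polytope_imp_convex)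
    then have "\<Inter>(insert P (\<F> ` A)) face_of P"
      using facet by (intro face_of_Inter) auto
    then have G: "G face_of P"
      by (simp add: G_def)
    have sub: "F \<subseteq> G \<longleftrightarrow> A \<subseteq> X F" if "F face_of P" for F
      using A face_of_imp_subset[OF that] by (auto simp: G_def X_def)
    \<comment> \<open>The faces of \<open>P\<close> inside the face \<open>G\<close> are the faces
      of \<open>G\<close>, so the signed count is the Euler sum of \<open>G\<close>, or an empty sum
      if \<open>G\<close> is empty.\<close>
    have eq: "{F. F \<in> \<Phi> \<and> A \<subseteq> X F} = {F. F face_of G \<and> F \<noteq> {}}"
      using sub face_of_face[OF G] by (auto simp: \<Phi>_def)
    have "A \<in> facet_complex m \<F> \<longleftrightarrow> G \<noteq> {}"
    proof (cases "A = {}")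
      case True
      then show ?thesis using assms(2) by (simp add: facet_complex_def G_def)
    next
      case False
      then have "G = (\<Inter>i\<in>A. \<F> i)"
        using face_of_imp_subset[OF facet] by (auto simp: G_def)
      with False A show ?thesis by (simp add: facet_complex_def)
    qed
    moreover have "polytope G"
      using G assms(1) face_of_polytope_polytope by blast
    moreover have "{F. F face_of G \<and> F \<noteq> {}} = {}" if "G = {}"
      using that by auto
    ultimately show ?thesis
      unfolding eq using Euler_relation_polytope[of G] by auto
  qed
  have "subst2 (face_polynomial2 P) (-1) [:1, 1:] =
      (\<Sum>F\<in>\<Phi>. [:parity_sign F:] * (\<Sum>A\<in>Pow (X F). monom 1 (card A)))"
    by (simp add: subst2_face_polynomial2 \<Phi>_def linear_plus_one_power X flip: X(2))
  \<comment> \<open>Writing \<open>Pow (X F)\<close> as a restriction of the fixed range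
    \<open>Pow {1..m}\<close> prepares the exchange of sums.\<close>
  also have "\<dots> = (\<Sum>F\<in>\<Phi>. \<Sum>A | A \<in> Pow {1..m} \<and> A \<subseteq> X F. monom (parity_sign F) (card A))"
    by (intro sum.cong refl)
      (auto simp: sum_distrib_left smult_monom X_def intro!: sum.cong)
  also have "\<dots> = (\<Sum>A\<in>Pow {1..m}. \<Sum>F | F \<in> \<Phi> \<and> A \<subseteq> X F. monom (parity_sign F) (card A))"
    by (rule sum.swap_restrict) (auto simp: fin)
  also have "\<dots> = (\<Sum>A\<in>Pow {1..m}. monom (if A \<in> facet_complex m \<F> then 1 else 0) (card A))"
    by (intro sum.cong refl) (simp add: key monom_sum flip: key)
  also have "\<dots> = f_polynomial (facet_complex m \<F>)"
    unfolding f_polynomial_def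
    by (intro sum.mono_neutral_cong_right) (auto simp: facet_complex_def)
  finally show ?thesis by simp
qed

end
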